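(* Let $X$ and $U$ be nonempty sets, let $\mathcal{A}$ be a $\sigma$-algebra on $X$, and let $\mathcal{F},\mathcal{G}$ be $\sigma$-algebras on $U$. If at least one of $\mathcal{F}$ and $\mathcal{G}$ is given by a countable partition, then $$(\mathcal{A}\otimes\mathcal{F})\cap(\mathcal{A}\otimes\mathcal{G})=\mathcal{A}\otimes(\mathcal{F}\cap\mathcal{G}).$$ More generally, if $\mathcal{F}\cap\mathcal{G}$ is given by a countable partition, then the same equality holds.
   Context: For $\sigma$-algebras $\mathcal{C}$ on a set $Y$ and $\mathcal{D}$ on a set $Z$, the product $\mathcal{C}\otimes\mathcal{D}$ is the smallest $\sigma$-algebra on $Y\times Z$ containing all rectangles $C\times D$ with $C\in\mathcal{C}$, $D\in\mathcal{D}$. A $\sigma$-algebra $\mathcal{C}$ is given by a countable partition if there are countably many (possibly finitely many) pairwise disjoint nonempty sets $C_1,C_2,\dots$ in $\mathcal{C}$ such that $\mathcal{C}$ is exactly the collection of all unions $\bigcup_{i\in I}C_i$, where $I$ ranges over all subsets of the index set. *)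

theory Defs
  imports "HOL-Analysis.Analysis"
begin

definition product_sigma ::
  "'a set \<Rightarrow> 'a set set \<Rightarrow> 'b set \<Rightarrow> 'b set set \<Rightarrow> ('a \<times> 'b) set set" where
  "product_sigma Y \<C> Z \<D> = sigma_sets (Y \<times> Z) {C \<times> D | C D. C \<in> \<C> \<and> D \<in> \<D>}"

lemma product_sigma_eq_sets_pair_measure:
  assumes "sigma_algebra Y \<C>" "sigma_algebra Z \<D>"
  shows "product_sigma Y \<C> Z \<D> = sets (sigma Y \<C> \<Otimes>\<^sub>M sigma Z \<D>)"
proof -
  interpret C: sigma_algebra Y \<C> by fact
  interpret D: sigma_algebra Z \<D> by fact
  show ?thesis
    by (simp add: product_sigma_def sets_pair_measure C.space_closed D.space_closed)
qed

(* The pairwise disjoint nonempty sets C_1, C_2, ... are given by their set P: being disjoint and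
   nonempty they are distinct, so subsets of the index set correspond to subsets of P. *)
definition given_by_countable_partition :: "'a set set \<Rightarrow> bool" where
  "given_by_countable_partition \<C> \<longleftrightarrow>
     (\<exists>P. countable P \<and> disjoint P \<and> {} \<notin> P \<and> P \<subseteq> \<C> \<and> \<C> = {\<Union>I | I. I \<subseteq> P})"

end

(* A set M lying in both products has all its vertical sections M_x in H = F \<inter> G. If H has countably
   many atoms K, each in H, then every M_x is a union of atoms, so M is the countable union of the
   rectangles M^u \<times> K, where u is any point of K and the horizontal section M^u is in A. A countable
   partition provides such atoms, and they are inherited by sub-sigma-algebras. *)

theory Submission
  imports Defs
begin

text \<open>The intersection may be uncountable, so an atom need not belong to
  \<open>\<H>\<close>.\<close>

definition atom :: "'a set set \<Rightarrow> 'a \<Rightarrow> 'a set" where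
  "atom \<H> u = \<Inter>{h \<in> \<H>. u \<in> h}"

text \<open>Formulated through the atoms of points rather than a chosen partition, so that it can be
  compared directly between a sigma-algebra and a smaller one.\<close>

definition countably_atomic :: "'a set \<Rightarrow> 'a set set \<Rightarrow> bool" where
  "countably_atomic U \<H> \<longleftrightarrow> countable (atom \<H> ` U) \<and> atom \<H> ` U \<subseteq> \<H>"

lemma mem_atom: "u \<in> atom \<H> u"
  by (simp add: atom_def)

lemma atom_subset_iff: "h \<in> \<H> \<Longrightarrow> atom \<H> u \<subseteq> h \<longleftrightarrow> u \<in> h"
  by (auto simp: atom_def)

text \<open>The atom of \<open>u\<close> is the block \<open>p\<close> containing \<open>u\<close>:
  this block is itself a member, and any member containing \<open>u\<close> is a union of blocks,
  one of which meets \<open>p\<close> and hence equals \<open>p\<close>.\<close>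

lemma countably_atomic_if_partition:
  assumes "U \<in> \<C>" and "given_by_countable_partition \<C>"
  shows "countably_atomic U \<C>"
proof -
  obtain P where P: "countable P" "disjoint P" "P \<subseteq> \<C>" "\<C> = {\<Union>I | I. I \<subseteq> P}"
    using assms(2) unfolding given_by_countable_partition_def by blast
  have "atom \<C> u \<in> P" if u: "u \<in> U" for u
  proof -
    obtain p where p: "p \<in> P" "u \<in> p"
      using assms(1) u P(4) by blast
    have "p \<subseteq> h" if h: "h \<in> \<C>" "u \<in> h" for h
    proof -
      obtain I q where I: "h = \<Union>I" "I \<subseteq> P" "q \<in> I" "u \<in> q"
        using h P(4) by blast
      then have "q = p"
        using P(2) p unfolding disjoint_def by blast
      then show ?thesis using I by blast
    qed
    then have "atom \<C> u = p"
      using p P(3) unfolding atom_def by blast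
    then show ?thesis using p by simp
  qed
  then have "atom \<C> ` U \<subseteq> P"
    by (rule image_subsetI)
  then show ?thesis
    unfolding countably_atomic_def using countable_subset P(1) subset_trans[OF _ P(3)] by auto
qed

text \<open>A set of \<open>\<H>\<close> is also in \<open>\<F>\<close>, so it contains
  \<open>u\<close> exactly when it contains \<open>atom \<F> u\<close>. Hence
  \<open>atom \<H> u\<close> is a function of \<open>atom \<F> u\<close>, and countability carries
  over.\<close>

lemma countably_atomic_subalgebra:
  assumes "sigma_algebra U \<H>" and "\<H> \<subseteq> \<F>" and "countably_atomic U \<F>"
  shows "countably_atomic U \<H>"
proof -
  interpret H: sigma_algebra U \<H> by fact
  have sub: "atom \<F> u \<subseteq> h \<longleftrightarrow> u \<in> h" if "h \<in> \<H>" for h u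
    using that assms(2) by (intro atom_subset_iff) auto
  have cnt: "countable (atom \<F> ` U)"
    using assms(3) by (simp add: countably_atomic_def)
  have "atom \<H> u = \<Inter>{h \<in> \<H>. atom \<F> u \<subseteq> h}" for u
    unfolding atom_def[of \<H>] using sub by blast
  then have "atom \<H> ` U = (\<lambda>k. \<Inter>{h \<in> \<H>. k \<subseteq> h}) ` atom \<F> ` U"
    by (simp add: image_image)
  then have "countable (atom \<H> ` U)"
    using cnt by simp
  moreover have "atom \<H> u \<in> \<H>" if u: "u \<in> U" for u
  proof -
    (* One separating set per atom of \<F> outside atom \<H> u suffices, so the intersection is countable. *)
    define D where "D = {k \<in> atom \<F> ` U. \<exists>h\<in>\<H>. u \<in> h \<and> \<not> k \<subseteq> h}"
    have "\<forall>k\<in>D. \<exists>h. h \<in> \<H> \<and> u \<in> h \<and> \<not> k \<subseteq> h"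
      unfolding D_def by blast
    then obtain g where g: "\<And>k. k \<in> D \<Longrightarrow> g k \<in> \<H> \<and> u \<in> g k \<and> \<not> k \<subseteq> g k"
      by metis
    have "countable D"
      unfolding D_def using cnt by (rule countable_subset[rotated]) blast
    \<comment> \<open>The factor \<open>U\<close> handles \<open>D = {}\<close>, where the
      intersection over \<open>D\<close> is \<open>UNIV\<close>.\<close>
    moreover have "atom \<H> u = U \<inter> (\<Inter>k\<in>D. g k)"
    proof
      show "atom \<H> u \<subseteq> U \<inter> (\<Inter>k\<in>D. g k)"
        unfolding atom_def using g u H.top by blast
      show "U \<inter> (\<Inter>k\<in>D. g k) \<subseteq> atom \<H> u"
      proof
        fix v assume v: "v \<in> U \<inter> (\<Inter>k\<in>D. g k)"
        \<comment> \<open>Otherwise \<open>h\<close> separates \<open>u\<close> from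
          \<open>v\<close>, so \<open>atom \<F> v\<close> is in \<open>D\<close>; but
          \<open>v\<close> lies in its separating set, which must then contain the whole
          atom.\<close>
        have "v \<in> h" if h: "h \<in> \<H>" "u \<in> h" for h
        proof (rule ccontr)
          assume "v \<notin> h"
          then have D: "atom \<F> v \<in> D"
            unfolding D_def using v h sub[OF h(1)] by auto
          then have "atom \<F> v \<subseteq> g (atom \<F> v)"
            using v g[OF D] sub[of "g (atom \<F> v)" v] by simp
          then show False using g[OF D] by simp
        qed
        then show "v \<in> atom \<H> u"
          by (simp add: atom_def)
      qed
    qed
    ultimately show ?thesis
      using g by (cases "D = {}") (auto intro!: H.Int H.countable_INT')
  qed
  ultimately show ?thesis
    unfolding countably_atomic_def by blast
qed

lemma product_sigma_mono:
  "\<D> \<subseteq> \<D>' \<Longrightarrow> product_sigma Y \<C> Z \<D> \<subseteq> product_sigma Y \<C> Z \<D>'"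
  unfolding product_sigma_def by (intro sigma_sets_mono') blast

text \<open>As \<open>\<C>\<close> and \<open>\<D>\<close> are already sigma-algebras, they are the
  measurable sets of the measures they generate, so the section theorems for pair measures
  apply.\<close>

lemma
  assumes "sigma_algebra Y \<C>" "sigma_algebra Z \<D>" and M: "M \<in> product_sigma Y \<C> Z \<D>"
  shows product_sigma_section1: "Pair x -` M \<in> \<D>"
    and product_sigma_section2: "(\<lambda>x. (x, z)) -` M \<in> \<C>"
    and product_sigma_subset: "M \<subseteq> Y \<times> Z"
proof -
  interpret C: sigma_algebra Y \<C> by fact
  interpret D: sigma_algebra Z \<D> by fact
  have M': "M \<in> sets (sigma Y \<C> \<Otimes>\<^sub>M sigma Z \<D>)"
    using M assms by (simp add: product_sigma_eq_sets_pair_measure)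
  show "Pair x -` M \<in> \<D>"
    using sets_Pair1[OF M'] by simp
  show "(\<lambda>x. (x, z)) -` M \<in> \<C>"
    using sets_Pair2[OF M'] by simp
  show "M \<subseteq> Y \<times> Z"
    using sets.sets_into_space[OF M'] by (simp add: space_pair_measure C.space_closed D.space_closed)
qed

lemma product_sigma_Int_if_countably_atomic:
  assumes A: "sigma_algebra X \<A>" and F: "sigma_algebra U \<F>" and G: "sigma_algebra U \<G>"
    and at: "countably_atomic U (\<F> \<inter> \<G>)"
  shows "product_sigma X \<A> U \<F> \<inter> product_sigma X \<A> U \<G> = product_sigma X \<A> U (\<F> \<inter> \<G>)"
proof
  show "product_sigma X \<A> U (\<F> \<inter> \<G>) \<subseteq> product_sigma X \<A> U \<F> \<inter> product_sigma X \<A> U \<G>"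
    by (simp add: product_sigma_mono)
  show "product_sigma X \<A> U \<F> \<inter> product_sigma X \<A> U \<G> \<subseteq> product_sigma X \<A> U (\<F> \<inter> \<G>)"
  proof
    fix M assume M: "M \<in> product_sigma X \<A> U \<F> \<inter> product_sigma X \<A> U \<G>"
    interpret A: sigma_algebra X \<A> by fact
    interpret F: sigma_algebra U \<F> by fact
    interpret G: sigma_algebra U \<G> by fact
    define K where "K = atom (\<F> \<inter> \<G>)"
    \<comment> \<open>Membership of \<open>M\<close> in both products puts the section in
      \<open>\<F>\<close> and in \<open>\<G>\<close>, so it contains the whole atom of each of its
      points.\<close>
    have sub: "K u \<subseteq> Pair x -` M \<longleftrightarrow> (x, u) \<in> M" for x u
      using product_sigma_section1[OF A F, of M x] product_sigma_section1[OF A G, of M x] M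
      by (simp add: K_def atom_subset_iff)
    \<comment> \<open>One representative point per atom makes \<open>R\<close> depend on the atom
      alone, so the union below runs over a countable set.\<close>
    define r where "r = inv_into U K"
    have r: "r k \<in> U" "K (r k) = k" if "k \<in> K ` U" for k
      using that by (auto simp: r_def inv_into_into f_inv_into_f)
    define R where "R k = (\<lambda>x. (x, r k)) -` M \<times> k" for k
    have "M = (\<Union>k\<in>K ` U. R k)"
    proof (intro equalityI subrelI)
      fix x v assume xv: "(x, v) \<in> M"
      then have "v \<in> U"
        using product_sigma_subset[OF A F] M by blast
      \<comment> \<open>\<open>v\<close> and \<open>r (K v)\<close> have the same atom, so the
        section at \<open>x\<close> contains both or neither.\<close>
      then have "(x, r (K v)) \<in> M"
        using sub[of "r (K v)" x] sub[of v x] xv r by simp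
      then have "(x, v) \<in> R (K v)"
        by (simp add: R_def K_def mem_atom)
      then show "(x, v) \<in> (\<Union>k\<in>K ` U. R k)"
        using \<open>v \<in> U\<close> by blast
    next
      fix x v assume "(x, v) \<in> (\<Union>k\<in>K ` U. R k)"
      then obtain k where "k \<in> K ` U" "(x, r k) \<in> M" "v \<in> k"
        by (auto simp: R_def)
      then show "(x, v) \<in> M"
        using sub[of "r k" x] r by auto
    qed
    moreover have "countable (K ` U)" and K: "K ` U \<subseteq> \<F> \<inter> \<G>"
      using at by (simp_all add: countably_atomic_def K_def)
    moreover have "R k \<in> product_sigma X \<A> U (\<F> \<inter> \<G>)" if "k \<in> K ` U" for k
      unfolding R_def product_sigma_def
      using product_sigma_section2[OF A F, of M "r k"] M K that
      by (intro sigma_sets.Basic) blast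
    moreover have "sigma_algebra (X \<times> U) (product_sigma X \<A> U (\<F> \<inter> \<G>))"
      unfolding product_sigma_def
      by (rule sigma_algebra_sigma_sets) (use A.space_closed F.space_closed in blast)
    ultimately show "M \<in> product_sigma X \<A> U (\<F> \<inter> \<G>)"
      by (metis (no_types, lifting) image_subsetI sigma_algebra.countable_UN')
  qed
qed

theorem theorem2p2:
  fixes X :: "'a set" and U :: "'b set"
    and \<A> :: "'a set set" and \<F> \<G> :: "'b set set"
  assumes "X \<noteq> {}" and "U \<noteq> {}"
    and "sigma_algebra X \<A>" and "sigma_algebra U \<F>" and "sigma_algebra U \<G>"
  shows "(given_by_countable_partition \<F> \<or> given_by_countable_partition \<G> \<longrightarrow>
            product_sigma X \<A> U \<F> \<inter> product_sigma X \<A> U \<G> = product_sigma X \<A> U (\<F> \<inter> \<G>))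
       \<and> (given_by_countable_partition (\<F> \<inter> \<G>) \<longrightarrow>
            product_sigma X \<A> U \<F> \<inter> product_sigma X \<A> U \<G> = product_sigma X \<A> U (\<F> \<inter> \<G>))"
proof -
  interpret F: sigma_algebra U \<F> by fact
  interpret G: sigma_algebra U \<G> by fact
  have FG: "sigma_algebra U (\<F> \<inter> \<G>)"
    using F.space_closed by (auto simp: sigma_algebra_iff2)
  \<comment> \<open>A partition of \<open>\<F>\<close> or \<open>\<G>\<close> yields countably many
    atoms there, inherited by the intersection; a partition of the intersection yields them
    directly.\<close>
  have "countably_atomic U (\<F> \<inter> \<G>)"
    if "given_by_countable_partition \<F> \<or> given_by_countable_partition \<G> \<or>
      given_by_countable_partition (\<F> \<inter> \<G>)"
    using that countably_atomic_if_partition[of U]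
      countably_atomic_subalgebra[OF FG, of \<F>] countably_atomic_subalgebra[OF FG, of \<G>]
    by auto
  then show ?thesis
    using product_sigma_Int_if_countably_atomic[OF assms(3-5)] by blast
qed

end
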